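(* For all nonnegative integers $n$, $$(2n+1)E_{2n}=\sum_{k=0}^{n}\frac{4^{k+1}-1}{k+1}\bigl(2^{2k+2}-2^{2n+1}\bigr)\binom{2n+1}{2k+1}B_{2k+2}B_{2n-2k}.$$
   Context: The Bernoulli polynomials $B_n(z)$ and Euler polynomials $E_n(z)$ ($n=0,1,2,\dots$; $z\in\mathbb{C}$) are defined by $\frac{t e^{zt}}{e^t-1}=\sum_{n=0}^\infty B_n(z)\frac{t^n}{n!}$ for $|t|<2\pi$ and $\frac{2e^{zt}}{e^t+1}=\sum_{n=0}^\infty E_n(z)\frac{t^n}{n!}$ for $|t|<\pi$. The Bernoulli numbers are $B_n=B_n(0)$ and the Euler numbers are $E_n=2^nE_n(1/2)$. *)

theory Defs
  imports "HOL-Complex_Analysis.Complex_Analysis"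
begin

text \<open>
  The generating functions are read as in the classical definition, as pointwise convergent
  expansions on a disc.  At \<open>t = 0\<close> the left-hand side of the Bernoulli expansion has a
  removable singularity, whereas HOL evaluates \<open>0 / 0\<close> to \<open>0\<close>, so that point is left out.
  The lemmas \<open>bernpoly_sums\<close>, \<open>bernpoly_unique\<close>, \<open>eulerpoly_sums\<close> and \<open>eulerpoly_unique\<close> show
  that both definite descriptions denote.
\<close>

definition bernpoly :: "nat \<Rightarrow> complex \<Rightarrow> complex" where
  "bernpoly n z = (THE b. \<forall>t::complex. 0 < norm t \<and> norm t < 2 * pi \<longrightarrow>
     (\<lambda>k. b k * (t ^ k / fact k)) sums (t * exp (z * t) / (exp t - 1))) n"

definition eulerpoly :: "nat \<Rightarrow> complex \<Rightarrow> complex" where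
  "eulerpoly n z = (THE e. \<forall>t::complex. norm t < pi \<longrightarrow>
     (\<lambda>k. e k * (t ^ k / fact k)) sums (2 * exp (z * t) / (exp t + 1))) n"

definition bernoulli_number :: "nat \<Rightarrow> complex" where
  "bernoulli_number n = bernpoly n 0"

definition euler_number :: "nat \<Rightarrow> complex" where
  "euler_number n = 2 ^ n * eulerpoly n (1 / 2)"

lemma exp_series_coeffs_unique:
  fixes b b' :: "nat \<Rightarrow> complex"
  assumes r: "r > 0"
    and b: "\<And>t. 0 < norm t \<Longrightarrow> norm t < r \<Longrightarrow> (\<lambda>k. b k * (t ^ k / fact k)) sums F t"
    and b': "\<And>t. 0 < norm t \<Longrightarrow> norm t < r \<Longrightarrow> (\<lambda>k. b' k * (t ^ k / fact k)) sums F t"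
  shows "b = b'"
proof -
  define c where "c k = (b k - b' k) / fact k" for k
  have c: "(\<lambda>k. c k * t ^ k) sums 0" if "t \<noteq> 0" "norm t < r" for t
  proof -
    have "(\<lambda>k. b k * (t ^ k / fact k) - b' k * (t ^ k / fact k)) sums (F t - F t)"
      using that by (intro sums_diff b b') auto
    also have "(\<lambda>k. b k * (t ^ k / fact k) - b' k * (t ^ k / fact k)) = (\<lambda>k. c k * t ^ k)"
      by (simp add: c_def fun_eq_iff field_simps)
    finally show ?thesis by simp
  qed
  have "((\<lambda>_::complex. 0) \<longlongrightarrow> c 0) (at 0)"
    by (rule powser_limit_0_strong[OF r]) (rule c)
  hence c0: "c 0 = 0"
    by (simp add: tendsto_const_iff)
  have c': "(\<lambda>k. c k * t ^ k) sums 0" if "norm t < r" for t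
  proof (cases "t = 0")
    case True
    have "(\<lambda>k. c k * 0 ^ k) sums c 0" by (rule powser_sums_zero)
    with True c0 show ?thesis by simp
  qed (use c that in blast)
  have "c m = 0" for m
  proof (rule ccontr)
    assume m: "c m \<noteq> 0"
    with c0 have "m > 0" by (cases m) auto
    obtain s where s: "0 < s" "\<And>z. z \<in> cball 0 s - {0::complex} \<Longrightarrow> (0::complex) \<noteq> 0"
      using powser_0_nonzero[of r 0 c "\<lambda>_. 0" m] r c' m \<open>m > 0\<close> by auto
    have "complex_of_real s \<in> cball 0 s - {0}" using s(1) by simp
    with s(2) show False by blast
  qed
  thus ?thesis by (auto simp: c_def fun_eq_iff)
qed

lemma ex_exp_series_coeffs:
  assumes "f holomorphic_on ball 0 r"
  shows "\<exists>b. \<forall>t. norm t < r \<longrightarrow> (\<lambda>k. b k * (t ^ k / fact k)) sums f t"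
proof (intro exI allI impI)
  fix t :: complex assume "norm t < r"
  hence "t \<in> ball 0 r" by simp
  from holomorphic_power_series[OF assms this]
  show "(\<lambda>k. (deriv ^^ k) f 0 * (t ^ k / fact k)) sums f t" by simp
qed

lemma exp_neq_one_in_disc:
  fixes t :: complex
  assumes "0 < norm t" "norm t < 2 * pi"
  shows "exp t \<noteq> 1"
proof
  assume "exp t = 1"
  then obtain n :: int where n: "Re t = 0" "Im t = of_int (2 * n) * pi"
    by (auto simp: exp_eq_1)
  hence nt: "norm t = 2 * pi * \<bar>of_int n\<bar>" by (simp add: cmod_def abs_mult)
  have "n \<noteq> 0" using nt assms by auto
  hence "1 \<le> \<bar>real_of_int n\<bar>" by linarith
  hence "2 * pi * 1 \<le> 2 * pi * \<bar>real_of_int n\<bar>" by (intro mult_left_mono) auto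
  with nt assms show False by simp
qed

lemma exp_neq_minus_one_in_disc:
  fixes t :: complex
  assumes "norm t < pi"
  shows "exp t + 1 \<noteq> 0"
proof
  assume *: "exp t + 1 = 0"
  hence "exp t = - 1" by (simp add: add_eq_0_iff2)
  hence "exp (2 * t) = 1" by (simp add: exp_double)
  moreover have "t \<noteq> 0" using * by auto
  ultimately show False
    using exp_neq_one_in_disc[of "2 * t"] assms by (simp add: norm_mult)
qed

lemma ex_bernpoly:
  fixes z :: complex
  shows "\<exists>b. \<forall>t. 0 < norm t \<and> norm t < 2 * pi \<longrightarrow>
     (\<lambda>k. b k * (t ^ k / fact k)) sums (t * exp (z * t) / (exp t - 1))"
proof -
  define g :: "complex \<Rightarrow> complex" where "g t = (if t = 0 then 1 else (exp t - 1) / t)" for t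
  have "((\<lambda>t::complex. exp t - 1) has_field_derivative 1) (at 0)"
    by (auto intro!: derivative_eq_intros)
  hence d: "deriv (\<lambda>t::complex. exp t - 1) 0 = 1" by (rule DERIV_imp_deriv)
  have g: "g holomorphic_on UNIV"
    by (rule pole_theorem_open_0[of "\<lambda>t. exp t - 1" _ 0])
       (auto intro!: holomorphic_intros simp: g_def d)
  have nz: "g t \<noteq> 0" if "t \<in> ball 0 (2 * pi)" for t
    using exp_neq_one_in_disc[of t] that by (auto simp: g_def)
  have "(\<lambda>t. exp (z * t) / g t) holomorphic_on ball 0 (2 * pi)"
    using nz by (intro holomorphic_intros holomorphic_on_subset[OF g]) auto
  from ex_exp_series_coeffs[OF this] obtain b where
    b: "\<And>t. norm t < 2 * pi \<Longrightarrow> (\<lambda>k. b k * (t ^ k / fact k)) sums (exp (z * t) / g t)"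
    by blast
  have "exp (z * t) / g t = t * exp (z * t) / (exp t - 1)" if "0 < norm t" for t
    using that by (simp add: g_def)
  hence "\<forall>t. 0 < norm t \<and> norm t < 2 * pi \<longrightarrow>
      (\<lambda>k. b k * (t ^ k / fact k)) sums (t * exp (z * t) / (exp t - 1))"
    using b by (metis (no_types, lifting))
  thus ?thesis by blast
qed

lemma ex_eulerpoly:
  fixes z :: complex
  shows "\<exists>e. \<forall>t. norm t < pi \<longrightarrow>
     (\<lambda>k. e k * (t ^ k / fact k)) sums (2 * exp (z * t) / (exp t + 1))"
  by (intro ex_exp_series_coeffs holomorphic_intros exp_neq_minus_one_in_disc) simp

lemma bernpoly_unique:
  assumes "\<And>t. 0 < norm t \<Longrightarrow> norm t < 2 * pi \<Longrightarrow>
             (\<lambda>k. b k * (t ^ k / fact k)) sums (t * exp (z * t) / (exp t - 1))"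
  shows "bernpoly n z = b n"
proof -
  have "(THE c. \<forall>t. 0 < norm t \<and> norm t < 2 * pi \<longrightarrow>
          (\<lambda>k. c k * (t ^ k / fact k)) sums (t * exp (z * t) / (exp t - 1))) = b"
  proof (rule the_equality)
    fix c assume "\<forall>t. 0 < norm t \<and> norm t < 2 * pi \<longrightarrow>
          (\<lambda>k. c k * (t ^ k / fact k)) sums (t * exp (z * t) / (exp t - 1))"
    thus "c = b"
      using assms
      by (intro exp_series_coeffs_unique[of "2 * pi" _ "\<lambda>t. t * exp (z * t) / (exp t - 1)"]) simp_all
  qed (use assms in blast)
  thus ?thesis by (simp add: bernpoly_def)
qed

lemma bernpoly_sums:
  assumes "0 < norm t" "norm t < 2 * pi"
  shows "(\<lambda>k. bernpoly k z * (t ^ k / fact k)) sums (t * exp (z * t) / (exp t - 1))"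
proof -
  obtain c where c: "\<forall>t. 0 < norm t \<and> norm t < 2 * pi \<longrightarrow>
      (\<lambda>k. c k * (t ^ k / fact k)) sums (t * exp (z * t) / (exp t - 1))"
    using ex_bernpoly[of z] by blast
  hence "(\<lambda>k. bernpoly k z) = c"
    by (intro ext bernpoly_unique) blast
  hence "\<And>k. bernpoly k z = c k" by (rule fun_cong)
  with c assms show ?thesis by simp
qed

lemma eulerpoly_unique:
  assumes "\<And>t. norm t < pi \<Longrightarrow>
             (\<lambda>k. e k * (t ^ k / fact k)) sums (2 * exp (z * t) / (exp t + 1))"
  shows "eulerpoly n z = e n"
proof -
  have "(THE c. \<forall>t. norm t < pi \<longrightarrow>
          (\<lambda>k. c k * (t ^ k / fact k)) sums (2 * exp (z * t) / (exp t + 1))) = e"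
  proof (rule the_equality)
    fix c assume "\<forall>t. norm t < pi \<longrightarrow>
          (\<lambda>k. c k * (t ^ k / fact k)) sums (2 * exp (z * t) / (exp t + 1))"
    thus "c = e"
      using assms
      by (intro exp_series_coeffs_unique[of pi _ "\<lambda>t. 2 * exp (z * t) / (exp t + 1)"]) simp_all
  qed (use assms in blast)
  thus ?thesis by (simp add: eulerpoly_def)
qed

lemma eulerpoly_sums:
  assumes "norm t < pi"
  shows "(\<lambda>k. eulerpoly k z * (t ^ k / fact k)) sums (2 * exp (z * t) / (exp t + 1))"
proof -
  obtain c where c: "\<forall>t. norm t < pi \<longrightarrow>
      (\<lambda>k. c k * (t ^ k / fact k)) sums (2 * exp (z * t) / (exp t + 1))"
    using ex_eulerpoly[of z] by blast
  hence "(\<lambda>k. eulerpoly k z) = c"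
    by (intro ext eulerpoly_unique) blast
  hence "\<And>k. eulerpoly k z = c k" by (rule fun_cong)
  with c assms show ?thesis by simp
qed

end

theory Submission
  imports Defs
begin

text \<open>
  Let \<open>S(t) = 1 / cosh t\<close> and \<open>\<beta>(t) = (t/2) coth (t/2)\<close>, the exponential generating functions of
  the Euler numbers and of the Bernoulli numbers without the term of index 1.
  Then \<open>\<beta>(4t) - \<beta>(2t) = t tanh t\<close> and \<open>2 \<beta>(t) - \<beta>(2t) = t / sinh t\<close>, and multiplying gives
  \<open>t\<^sup>2 S(t) = (\<beta>(4t) - \<beta>(2t)) (2 \<beta>(t) - \<beta>(2t))\<close>.
  Since \<open>\<beta>\<close> is even, comparing the coefficients of \<open>t\<^bsup>2n+2\<^esup>\<close> gives the identity.
\<close>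

text \<open>This carries the pointwise expansions over to formal power series, where the identities
  become ring identities. Convergence at the single point \<open>r / 2\<close> already makes the
  radius of convergence positive.\<close>

lemma has_fps_expansionI_sums:
  fixes F :: "complex fps"
  assumes "r > 0" and sums: "\<And>t. norm t < r \<Longrightarrow> (\<lambda>k. fps_nth F k * t ^ k) sums f t"
  shows "f has_fps_expansion F"
proof -
  have "norm (complex_of_real (r / 2)) \<le> fps_conv_radius F"
    unfolding fps_conv_radius_def
    using sums[of "complex_of_real (r / 2)"] \<open>r > 0\<close>
    by (intro conv_radius_geI) (auto simp: sums_iff)
  moreover have "0 < ereal (norm (complex_of_real (r / 2)))"
    using \<open>r > 0\<close> by simp
  ultimately have "fps_conv_radius F > 0"
    by (rule order_less_le_trans[rotated])
  moreover have "\<forall>\<^sub>F t in nhds 0. t \<in> ball 0 r"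
    using \<open>r > 0\<close> by (intro eventually_nhds_in_open) auto
  hence "\<forall>\<^sub>F t in nhds 0. eval_fps F t = f t"
    by eventually_elim (use sums in \<open>auto simp: eval_fps_def sums_iff\<close>)
  ultimately show ?thesis
    by (simp add: has_fps_expansion_def)
qed

definition bernoulli_fps :: "complex fps" where
  "bernoulli_fps = Abs_fps (\<lambda>k. bernoulli_number k / fact k)"

definition euler_fps :: "complex fps" where
  "euler_fps = Abs_fps (\<lambda>k. euler_number k / fact k)"

lemma bernoulli_fps_mult: "bernoulli_fps * (fps_exp 1 - 1) = fps_X"
proof -
  \<comment> \<open>The value at 0 is the constant term of the series, so the expansion holds there
    by construction. Its actual value is irrelevant below, because \<open>exp t - 1\<close> vanishes
    at 0.\<close>
  define f :: "complex \<Rightarrow> complex"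
    where "f t = (if t = 0 then bernoulli_number 0 else t / (exp t - 1))" for t
  have "f has_fps_expansion bernoulli_fps"
  proof (rule has_fps_expansionI_sums)
    fix t :: complex assume t: "norm t < 2 * pi"
    show "(\<lambda>k. fps_nth bernoulli_fps k * t ^ k) sums f t"
    proof (cases "t = 0")
      case True
      show ?thesis
        using powser_sums_zero[of "fps_nth bernoulli_fps"]
        by (simp add: f_def True bernoulli_fps_def)
    next
      case False
      with bernpoly_sums[of t 0] t show ?thesis
        by (simp add: f_def bernoulli_fps_def bernoulli_number_def)
    qed
  qed simp
  hence "(\<lambda>t. f t * (exp t - 1)) has_fps_expansion bernoulli_fps * (fps_exp 1 - 1)"
    by (intro fps_expansion_intros)
  moreover have "\<forall>\<^sub>F t in nhds 0. t \<in> ball (0::complex) (2 * pi)"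
    by (intro eventually_nhds_in_open) auto
  hence "\<forall>\<^sub>F t in nhds 0. f t * (exp t - 1) = t"
    by eventually_elim (use exp_neq_one_in_disc in \<open>auto simp: f_def\<close>)
  ultimately have "(\<lambda>t. t) has_fps_expansion bernoulli_fps * (fps_exp 1 - 1)"
    by (simp cong: has_fps_expansion_cong)
  thus ?thesis
    by (rule fps_expansion_unique_complex) (rule has_fps_expansion_fps_X)
qed

lemma euler_fps_mult: "euler_fps * (fps_exp 2 + 1) = 2 * fps_exp 1"
proof -
  \<comment> \<open>The factor \<open>2 ^ n\<close> in \<open>euler_number\<close> amounts to
    replacing t by 2t in the expansion at z = 1/2, which halves the radius to
    \<open>pi / 2\<close>.\<close>
  define f :: "complex \<Rightarrow> complex" where "f t = 2 * exp t / (exp (2 * t) + 1)" for t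
  have "f has_fps_expansion euler_fps"
  proof (rule has_fps_expansionI_sums)
    fix t :: complex assume t: "norm t < pi / 2"
    show "(\<lambda>k. fps_nth euler_fps k * t ^ k) sums f t"
      using eulerpoly_sums[of "2 * t" "1 / 2"] t
      by (simp add: f_def euler_fps_def euler_number_def norm_mult power_mult_distrib mult_ac)
  qed simp
  hence "(\<lambda>t. f t * (exp (2 * t) + 1)) has_fps_expansion euler_fps * (fps_exp 2 + 1)"
    by (intro fps_expansion_intros)
  moreover have "\<forall>\<^sub>F t in nhds 0. t \<in> ball (0::complex) (pi / 2)"
    by (intro eventually_nhds_in_open) auto
  hence "\<forall>\<^sub>F t in nhds 0. f t * (exp (2 * t) + 1) = 2 * exp t"
  proof eventually_elim
    case (elim t)
    thus ?case
      using exp_neq_minus_one_in_disc[of "2 * t"] by (simp add: f_def norm_mult)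
  qed
  ultimately have "(\<lambda>t. 2 * exp t) has_fps_expansion euler_fps * (fps_exp 2 + 1)"
    by (simp cong: has_fps_expansion_cong)
  moreover have "(\<lambda>t::complex. 2 * exp t) has_fps_expansion 2 * fps_exp 1"
    by (intro fps_expansion_intros)
  ultimately show ?thesis
    by (rule fps_expansion_unique_complex)
qed

text \<open>As \<open>B\<^sub>1 = -1/2\<close>, the added term removes the only odd coefficient.\<close>
definition even_bernoulli_fps :: "complex fps" where
  "even_bernoulli_fps = bernoulli_fps + fps_const (1 / 2) * fps_X"

text \<open>Since coth(t/2) = (e^t + 1)/(e^t - 1), this is the coth formula for \<beta>(ct) with the
  denominator cleared. The case c = 1 comes from \<open>bernoulli_fps_mult\<close>; substituting ct
  for t gives the rest.\<close>

lemma even_bernoulli_fps_scale: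
  "2 * (even_bernoulli_fps oo (fps_const c * fps_X)) * (fps_exp c - 1) =
     fps_const c * fps_X * (fps_exp c + 1)"
proof -
  have *: "2 * fps_const (1 / 2) = (1 :: complex fps)"
    by (simp add: numeral_fps_const)
  have "2 * even_bernoulli_fps * (fps_exp 1 - 1) =
      2 * (bernoulli_fps * (fps_exp 1 - 1)) + (2 * fps_const (1 / 2)) * fps_X * (fps_exp 1 - 1)"
    by (simp add: even_bernoulli_fps_def algebra_simps)
  also have "\<dots> = fps_X * (fps_exp 1 + 1)"
    unfolding bernoulli_fps_mult * by (simp add: algebra_simps)
  finally have "(2 * even_bernoulli_fps * (fps_exp 1 - 1)) oo (fps_const c * fps_X) =
      (fps_X * (fps_exp 1 + 1)) oo (fps_const c * fps_X)"
    by simp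
  moreover have "fps_exp 1 oo (fps_const c * fps_X) = fps_exp c"
    by (simp add: fps_eq_iff)
  ultimately show ?thesis
    by (simp add: fps_compose_mult_distrib fps_compose_add_distrib fps_compose_sub_distrib)
qed

lemma even_bernoulli_fps_nth_odd:
  assumes "odd k"
  shows "fps_nth even_bernoulli_fps k = 0"
proof -
  define x :: "complex fps" where "x = fps_exp 1"
  define y :: "complex fps" where "y = fps_exp (-1)"
  define C where "C = even_bernoulli_fps oo (fps_const (-1) * fps_X)"
  have xy: "x * y = 1"
    by (simp add: x_def y_def flip: fps_exp_add_mult)
  have "even_bernoulli_fps oo (fps_const 1 * fps_X) = even_bernoulli_fps"
    by (simp add: fps_eq_iff)
  hence 1: "2 * even_bernoulli_fps * (x - 1) = fps_X * (x + 1)"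
    using even_bernoulli_fps_scale[of 1] by (simp add: x_def)
  have m: "fps_const (-1) = (-1 :: complex fps)"
    by (simp add: fps_eq_iff)
  have 2: "2 * C * (y - 1) = - fps_X * (y + 1)"
    using even_bernoulli_fps_scale[of "-1"] unfolding C_def y_def m by simp
  \<comment> \<open>Multiplying by x turns y - 1 into 1 - x, so C satisfies the same linear equation
    as \<open>even_bernoulli_fps\<close>. Cancelling x - 1 shows that the series is even.\<close>
  have "2 * C * (x * y - x) = - fps_X * (x * y + x)"
    using 2 by algebra
  hence "2 * (x - 1) * even_bernoulli_fps = 2 * (x - 1) * C"
    using 1 unfolding xy by algebra
  moreover have "fps_nth (x - 1) 1 \<noteq> 0"
    by (simp add: x_def)
  hence "x - 1 \<noteq> 0"
    by (metis fps_zero_nth)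
  ultimately have "even_bernoulli_fps = C"
    by simp
  hence "fps_nth even_bernoulli_fps k = (-1) ^ k * fps_nth even_bernoulli_fps k"
    unfolding C_def by (metis fps_nth_compose_linear)
  thus ?thesis
    using assms by simp
qed

text \<open>In terms of x = e^t the hyperbolic identities are polynomial identities. Division is
  replaced by cancelling nonzero factors in the integral domain of formal power series.\<close>

lemma euler_fps_eq:
  "fps_X\<^sup>2 * euler_fps =
     ((even_bernoulli_fps oo (fps_const 4 * fps_X)) - (even_bernoulli_fps oo (fps_const 2 * fps_X))) *
     (2 * even_bernoulli_fps - (even_bernoulli_fps oo (fps_const 2 * fps_X)))"
proof -
  define x :: "complex fps" where "x = fps_exp 1"
  define B where "B = even_bernoulli_fps"
  define C where "C = even_bernoulli_fps oo (fps_const 2 * fps_X)"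
  define D where "D = even_bernoulli_fps oo (fps_const 4 * fps_X)"
  have exps: "fps_exp 2 = x\<^sup>2" "fps_exp 4 = x ^ 4"
    by (simp_all add: x_def fps_exp_power_mult)
  have "even_bernoulli_fps oo (fps_const 1 * fps_X) = even_bernoulli_fps"
    by (simp add: fps_eq_iff)
  hence B: "2 * B * (x - 1) = fps_X * (x + 1)"
    using even_bernoulli_fps_scale[of 1] by (simp add: x_def B_def)
  have C: "2 * C * (x\<^sup>2 - 1) = 2 * fps_X * (x\<^sup>2 + 1)"
    using even_bernoulli_fps_scale[of 2] by (simp add: exps C_def numeral_fps_const)
  have D: "2 * D * (x ^ 4 - 1) = 4 * fps_X * (x ^ 4 + 1)"
    using even_bernoulli_fps_scale[of 4] by (simp add: exps D_def numeral_fps_const)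
  have E: "euler_fps * (x\<^sup>2 + 1) = 2 * x"
    using euler_fps_mult by (simp add: exps x_def)
  have nz: "x\<^sup>2 - 1 \<noteq> 0" "x\<^sup>2 + 1 \<noteq> 0"
  proof -
    have "fps_nth (x\<^sup>2 - 1) 1 \<noteq> 0" "fps_nth (x\<^sup>2 + 1) 0 \<noteq> 0"
      by (simp_all flip: exps)
    thus "x\<^sup>2 - 1 \<noteq> 0" "x\<^sup>2 + 1 \<noteq> 0"
      by (metis fps_zero_nth)+
  qed
  \<comment> \<open>This is t tanh t; the extra factor comes from x^4 - 1 = (x^2 - 1)(x^2 +
    1).\<close>
  have "2 * (x\<^sup>2 - 1) * ((D - C) * (x\<^sup>2 + 1)) = 2 * (x\<^sup>2 - 1) * (fps_X * (x\<^sup>2 - 1))"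
    using C D by algebra
  hence DC: "(D - C) * (x\<^sup>2 + 1) = fps_X * (x\<^sup>2 - 1)"
    using nz by simp
  \<comment> \<open>This is t / sinh t, using (x + 1)^2 - (x^2 + 1) = 2x.\<close>
  have "2 * ((2 * B - C) * (x\<^sup>2 - 1)) = 2 * (2 * fps_X * x)"
    using B C by algebra
  hence BC: "(2 * B - C) * (x\<^sup>2 - 1) = 2 * fps_X * x"
    by (simp only: mult_cancel_left) simp
  have "((x\<^sup>2 - 1) * (x\<^sup>2 + 1)) * (fps_X\<^sup>2 * euler_fps) =
      ((x\<^sup>2 - 1) * (x\<^sup>2 + 1)) * ((D - C) * (2 * B - C))"
    using DC BC E by algebra
  thus ?thesis
    using nz by (simp add: B_def C_def D_def)
qed

theorem mainTheorem3:
  fixes n :: nat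
  shows "of_nat (2 * n + 1) * euler_number (2 * n) =
    (\<Sum>k=0..n. (4 ^ (k + 1) - 1) / of_nat (k + 1) * (2 ^ (2 * k + 2) - 2 ^ (2 * n + 1)) *
      of_nat ((2 * n + 1) choose (2 * k + 1)) *
      bernoulli_number (2 * k + 2) * bernoulli_number (2 * n - 2 * k))"
proof -
  define b where "b = fps_nth even_bernoulli_fps"
  have b_odd: "b k = 0" if "odd k" for k
    using that by (simp add: b_def even_bernoulli_fps_nth_odd)
  have b_even: "b k = bernoulli_number k / fact k" if "even k" for k
    using that by (auto simp: b_def even_bernoulli_fps_def bernoulli_fps_def)
  \<comment> \<open>The factor t^2 shifts index 2n to N. The two factors of \<open>g j\<close> are
    the coefficients of t^j in \<beta>(4t) - \<beta>(2t) and of t^(N-j) in 2\<beta>(t) -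
    \<beta>(2t).\<close>
  define N where "N = 2 * n + 2"
  define g where "g j = (4 ^ j - 2 ^ j) * b j * ((2 - 2 ^ (N - j)) * b (N - j))" for j
  have "euler_number (2 * n) / fact (2 * n) = fps_nth (fps_X\<^sup>2 * euler_fps) N"
    by (simp add: N_def euler_fps_def fps_X_power_mult_nth)
  also have "\<dots> = (\<Sum>j=0..N. g j)"
    unfolding euler_fps_eq fps_mult_nth g_def b_def
    by (intro sum.cong refl) (simp add: numeral_fps_const left_diff_distrib)
  \<comment> \<open>Odd j drop out by evenness of \<beta>, and j = 0 because 4^0 - 2^0 = 0.\<close>
  also have "\<dots> = (\<Sum>j\<in>(\<lambda>k. 2 * k + 2) ` {0..n}. g j)"
  proof (rule sum.mono_neutral_right)
    show "\<forall>j\<in>{0..N} - (\<lambda>k. 2 * k + 2) ` {0..n}. g j = 0"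
    proof
      fix j assume j: "j \<in> {0..N} - (\<lambda>k. 2 * k + 2) ` {0..n}"
      show "g j = 0"
      proof (cases "even j \<and> j \<noteq> 0")
        case True
        then obtain i where "j = 2 * i" "i \<noteq> 0" by (auto elim: evenE)
        hence "j = 2 * (i - 1) + 2" "i - 1 \<in> {0..n}"
          using j by (auto simp: N_def)
        with j show ?thesis by blast
      qed (auto simp: g_def b_odd)
    qed
  qed (auto simp: N_def)
  also have "\<dots> = (\<Sum>k=0..n. g (2 * k + 2))"
    by (subst sum.reindex) (auto simp: inj_on_def)
  finally have "euler_number (2 * n) = fact (2 * n) * (\<Sum>k=0..n. g (2 * k + 2))"
    by (simp add: field_simps)
  hence "of_nat (2 * n + 1) * euler_number (2 * n) =
      (\<Sum>k=0..n. fact (2 * n + 1) * g (2 * k + 2))"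
    by (simp flip: sum_distrib_left)
  also have "\<dots> = (\<Sum>k=0..n. (4 ^ (k + 1) - 1) / of_nat (k + 1) * (2 ^ (2 * k + 2) - 2 ^ (2 * n + 1)) *
      of_nat ((2 * n + 1) choose (2 * k + 1)) *
      bernoulli_number (2 * k + 2) * bernoulli_number (2 * n - 2 * k))"
  proof (intro sum.cong refl)
    fix k assume "k \<in> {0..n}"
    then obtain m where n: "n = k + m"
      by (auto simp: le_iff_add)
    define p q :: complex where "p = 4 ^ k" and "q = 4 ^ m"
    have pows: "(2::complex) ^ (2 * k) = p" "(2::complex) ^ (2 * m) = q"
      "(2::complex) ^ (2 * n) = p * q" "(4::complex) ^ k = p" "(4::complex) ^ (2 * k) = p * p"
      by (simp_all add: p_def q_def n power_mult power_add mult_2 flip: power_mult_distrib)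
    have choose: "of_nat ((2 * n + 1) choose (2 * k + 1)) =
        (fact (2 * n + 1) / (fact (2 * k + 1) * fact (2 * m)) :: complex)"
      by (subst binomial_fact) (auto simp: n)
    have fact: "(fact (2 * k + 2) :: complex) = 2 * of_nat (k + 1) * fact (2 * k + 1)"
      by (simp add: algebra_simps)
    have "fact (2 * n + 1) * g (2 * k + 2) =
        fact (2 * n + 1) * ((16 * (p * p) - 4 * p) * (2 - q) / (2 * of_nat (k + 1) * fact (2 * k + 1) * fact (2 * m)) *
          bernoulli_number (2 * k + 2) * bernoulli_number (2 * m))"
    proof -
      have "N - (2 * k + 2) = 2 * m"
        by (simp add: N_def n)
      thus ?thesis
        unfolding g_def fact[symmetric] by (simp add: b_even pows power_add del: fact_Suc)
    qed
    \<comment> \<open>The factor p is moved into the second bracket, where 4p = 2^(2k+2) and 2pq =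
      2^(2n+1). The 2 in front cancels the one from (2k+2)! = 2(k+1)(2k+1)!.\<close>
    also have "(16 * (p * p) - 4 * p) * (2 - q) = 2 * ((4 * p - 1) * (4 * p - 2 * (p * q)))"
      by (simp add: algebra_simps)
    also have "fact (2 * n + 1) * (2 * ((4 * p - 1) * (4 * p - 2 * (p * q))) /
          (2 * of_nat (k + 1) * fact (2 * k + 1) * fact (2 * m)) *
          bernoulli_number (2 * k + 2) * bernoulli_number (2 * m)) =
        (4 * p - 1) / of_nat (k + 1) * (4 * p - 2 * (p * q)) *
          (fact (2 * n + 1) / (fact (2 * k + 1) * fact (2 * m))) *
          bernoulli_number (2 * k + 2) * bernoulli_number (2 * m)"
      by (simp add: mult_ac del: fact_Suc of_nat_Suc of_nat_add)
    also have "\<dots> = (4 ^ (k + 1) - 1) / of_nat (k + 1) * (2 ^ (2 * k + 2) - 2 ^ (2 * n + 1)) *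
      of_nat ((2 * n + 1) choose (2 * k + 1)) *
      bernoulli_number (2 * k + 2) * bernoulli_number (2 * n - 2 * k)"
    proof -
      have "2 * n - 2 * k = 2 * m"
        by (simp add: n)
      thus ?thesis
        unfolding choose by (simp add: pows power_add del: fact_Suc of_nat_Suc of_nat_add)
    qed
    finally show "fact (2 * n + 1) * g (2 * k + 2) = \<dots>" .
  qed
  finally show ?thesis .
qed

end
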